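(* Let $T>0$ and $\gamma>0$ be real. For $p\in\mathbb{C}^+$ define $$g(p)=T\frac{\gamma-p}{\gamma+p}\,p,\qquad h(p)=g(p)-Tp,\qquad V(p)=e^{h(p)}.$$ Let $k\in\mathcal{K}(T)$ and $K(i\omega)=(\mathcal{F}k)(i\omega)$. Then: (i) $V\in H^\infty$, and $\widehat K(i\omega)=V(i\omega)K(i\omega)$ extends to a function $\widehat K(p)$ on $\mathbb{C}^+$ belonging to $H^2\cap H^\infty$. (ii) $|V(i\omega)|=\exp\!\left(\dfrac{2T\gamma\omega^2}{\gamma^2+\omega^2}\right)$ for all $\omega\in\mathbb{R}$. (iii) $\sup_{\gamma>0}|V(i\omega)|\le e^{T|\omega|}$ for all $\omega\in\mathbb{R}$. (iv) $V(i\omega)\to1$ as $\gamma\to+\infty$, for every $\omega\in\mathbb{R}$. (v) For every $\varepsilon>0$ and every $\Omega>0$ there exists $\gamma>0$ such that $|V(i\omega)-1|\le\varepsilon$ for all $\omega\in[-\Omega,\Omega]$.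
   Context: $\mathbb{C}^+=\{p\in\mathbb{C}:\operatorname{Re}p>0\}$. Fourier transform: $(\mathcal{F}k)(i\omega)=\int_{-\infty}^\infty e^{-i\omega t}k(t)\,dt$. Hardy spaces: for $r\in[1,\infty]$, $H^r$ is the space of holomorphic functions $h$ on $\mathbb{C}^+$ with $\sup_{s>0}\|h(s+i\cdot)\|_{L_r(\mathbb{R})}<\infty$. $\mathcal{K}(T)$ is the set of functions $k\in L_\infty(\mathbb{R})$, $k:\mathbb{R}\to\mathbb{R}$, with $k(t)=0$ for $t\notin[-T,0]$. *)

theory Defs
  imports "HOL-Analysis.Analysis"
begin

definition rhp :: "complex set" where
  "rhp = {p. Re p > 0}"

definition hardy :: "real \<Rightarrow> (complex \<Rightarrow> complex) \<Rightarrow> bool" where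
  "hardy r h \<longleftrightarrow> h holomorphic_on rhp \<and>
     (\<forall>s>0. integrable lborel (\<lambda>\<omega>::real. cmod (h (Complex s \<omega>)) powr r)) \<and>
     (\<exists>B. \<forall>s>0. (LINT \<omega>|lborel. cmod (h (Complex s \<omega>)) powr r) powr (1 / r) \<le> B)"

(* Hardy space H^infinity (for holomorphic, hence continuous, h the ess-sup on each
   line is the sup, so the condition is boundedness on C^+) *)
definition hardy_inf :: "(complex \<Rightarrow> complex) \<Rightarrow> bool" where
  "hardy_inf h \<longleftrightarrow> h holomorphic_on rhp \<and> (\<exists>B. \<forall>p\<in>rhp. cmod (h p) \<le> B)"

(* Fourier transform (F k)(i omega) = int e^{-i omega t} k(t) dt, as function of omega *)
definition fourier :: "(real \<Rightarrow> real) \<Rightarrow> real \<Rightarrow> complex" where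
  "fourier k \<omega> = (LINT t|lborel. exp (- (\<i> * of_real \<omega> * of_real t)) * of_real (k t))"

definition Kclass :: "real \<Rightarrow> (real \<Rightarrow> real) set" where
  "Kclass T = {k. k \<in> borel_measurable lborel \<and> (\<exists>B. AE t in lborel. \<bar>k t\<bar> \<le> B)
                  \<and> (\<forall>t. t \<notin> {-T..0} \<longrightarrow> k t = 0)}"

definition gfun :: "real \<Rightarrow> real \<Rightarrow> complex \<Rightarrow> complex" where
  "gfun T \<gamma> p = of_real T * ((of_real \<gamma> - p) / (of_real \<gamma> + p)) * p"

definition hfun :: "real \<Rightarrow> real \<Rightarrow> complex \<Rightarrow> complex" where
  "hfun T \<gamma> p = gfun T \<gamma> p - of_real T * p"

definition Vfun :: "real \<Rightarrow> real \<Rightarrow> complex \<Rightarrow> complex" where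
  "Vfun T \<gamma> p = exp (hfun T \<gamma> p)"

end

theory Submission
  imports Defs
begin

text \<open>
  On the imaginary axis h(i\<omega>) = 2T\<omega>^2 / (\<gamma> + i\<omega>), from which (ii)--(v) are direct estimates.
  On the closed right half-plane Re h(p) \<le> 2T\<gamma> - 2T Re p, so V is bounded and decays like
  exp(-2T Re p), while the Laplace transform Lk of k \<in> K(T) is entire and grows at most like
  exp(T Re p); hence V Lk is bounded and holomorphic there. For the H^2 bound, the exponentials
  exp(i(a + 2\<pi>n/T)t) are orthogonal on [-T,0], so Bessel's inequality bounds
  \<Sum>_n |Fu(a + 2\<pi>n/T)|^2 by T \<integral>u^2; integrating over the offset a \<in> [0, 2\<pi>/T) gives
  \<integral>|Fu|^2 \<le> 2\<pi>T sup|u|^2 without Plancherel's theorem. Applied to u(t) = exp(-st) k(t), this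
  controls V Lk on every vertical line Re p = s.
\<close>

lemma of_real_add_neq_zero:
  assumes "\<gamma> > 0" "Re p \<ge> 0"
  shows "of_real \<gamma> + p \<noteq> 0"
  using assms by (auto simp: complex_eq_iff)

lemma hfun_eq_quotient:
  assumes "of_real \<gamma> + p \<noteq> 0"
  shows "hfun T \<gamma> p = - 2 * of_real T * p^2 / (of_real \<gamma> + p)"
  using assms unfolding hfun_def gfun_def by (simp add: field_simps power2_eq_square)

lemma hfun_eq_partial_fraction:
  assumes "of_real \<gamma> + p \<noteq> 0"
  shows "hfun T \<gamma> p = - 2 * of_real T * (p - of_real \<gamma> + of_real (\<gamma>^2) / (of_real \<gamma> + p))"
  using assms unfolding hfun_def gfun_def by (simp add: field_simps power2_eq_square)

lemma Re_of_real_divide_nonneg: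
  assumes "\<gamma> > 0" "Re p \<ge> 0" "c \<ge> 0"
  shows "Re (of_real c / (of_real \<gamma> + p)) \<ge> 0"
proof -
  have "Re (of_real c / (of_real \<gamma> + p)) = c * (\<gamma> + Re p) / (cmod (of_real \<gamma> + p))^2"
    by (simp add: Re_divide cmod_power2)
  then show ?thesis using assms by simp
qed

lemma Re_hfun_le:
  assumes "T > 0" "\<gamma> > 0" "Re p \<ge> 0"
  shows "Re (hfun T \<gamma> p) \<le> 2 * T * \<gamma> - 2 * T * Re p"
proof -
  define w where "w = of_real (\<gamma>^2) / (of_real \<gamma> + p)"
  have "Re w \<ge> 0"
    unfolding w_def by (rule Re_of_real_divide_nonneg) (use assms in auto)
  then have "T * Re w \<ge> 0"
    using assms(1) by simp
  moreover have "Re (hfun T \<gamma> p) = - 2 * T * (Re p - \<gamma> + Re w)"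
    unfolding w_def hfun_eq_partial_fraction[OF of_real_add_neq_zero[OF assms(2,3)]] by simp
  ultimately show ?thesis
    by (simp add: algebra_simps)
qed

lemma norm_Vfun_le:
  assumes "T > 0" "\<gamma> > 0" "Re p \<ge> 0"
  shows "cmod (Vfun T \<gamma> p) \<le> exp (2 * T * \<gamma> - 2 * T * Re p)"
  using Re_hfun_le[OF assms] by (simp add: Vfun_def)

lemma Vfun_holomorphic: "\<gamma> > 0 \<Longrightarrow> Vfun T \<gamma> holomorphic_on {p. Re p > - \<gamma>}"
  unfolding Vfun_def hfun_def gfun_def
  by (intro holomorphic_intros) (auto simp: complex_eq_iff)

lemma Vfun_continuous_on: "\<gamma> > 0 \<Longrightarrow> continuous_on {p. Re p \<ge> 0} (Vfun T \<gamma>)"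
  by (rule holomorphic_on_imp_continuous_on[OF holomorphic_on_subset[OF Vfun_holomorphic]]) auto

lemma hardy_inf_Vfun:
  assumes "T > 0" "\<gamma> > 0"
  shows "hardy_inf (Vfun T \<gamma>)"
  unfolding hardy_inf_def
proof (intro conjI exI ballI)
  show "Vfun T \<gamma> holomorphic_on rhp"
    by (rule holomorphic_on_subset[OF Vfun_holomorphic]) (use assms in \<open>auto simp: rhp_def\<close>)
next
  fix p assume "p \<in> rhp"
  then have "Re p \<ge> 0"
    by (simp add: rhp_def)
  show "cmod (Vfun T \<gamma> p) \<le> exp (2 * T * \<gamma>)"
    by (rule order_trans[OF norm_Vfun_le[OF assms \<open>Re p \<ge> 0\<close>]]) (use assms \<open>Re p \<ge> 0\<close> in simp)
qed

lemma hfun_imag_axis: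
  assumes "\<gamma> > 0"
  shows "hfun T \<gamma> (\<i> * of_real \<omega>) = of_real (2 * T * \<omega>^2) / (of_real \<gamma> + \<i> * of_real \<omega>)"
  using assms by (subst hfun_eq_quotient) (auto simp: complex_eq_iff power_mult_distrib)

lemma norm_Vfun_imag_axis:
  assumes "\<gamma> > 0"
  shows "cmod (Vfun T \<gamma> (\<i> * of_real \<omega>)) = exp (2 * T * \<gamma> * \<omega>^2 / (\<gamma>^2 + \<omega>^2))"
  unfolding Vfun_def norm_exp_eq_Re hfun_imag_axis[OF assms]
  by (simp add: Re_divide power2_eq_square cmod_power2 field_simps)

lemma norm_hfun_imag_axis_le:
  assumes "\<gamma> > 0" "T > 0"
  shows "cmod (hfun T \<gamma> (\<i> * of_real \<omega>)) \<le> 2 * T * \<omega>^2 / \<gamma>"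
proof -
  have "\<gamma> \<le> cmod (of_real \<gamma> + \<i> * of_real \<omega>)"
    using complex_Re_le_cmod[of "of_real \<gamma> + \<i> * of_real \<omega>"] by simp
  then show ?thesis
    using assms unfolding hfun_imag_axis[OF assms(1)] norm_divide norm_of_real
    by (intro frac_le) auto
qed

lemma norm_Vfun_imag_axis_le_exp_abs:
  assumes "T > 0" "\<gamma> > 0"
  shows "cmod (Vfun T \<gamma> (\<i> * of_real \<omega>)) \<le> exp (T * \<bar>\<omega>\<bar>)"
proof -
  have "2 * \<gamma> * \<omega>^2 \<le> \<bar>\<omega>\<bar> * (\<gamma>^2 + \<omega>^2)"
    using mult_nonneg_nonneg[OF abs_ge_zero[of \<omega>] zero_le_power2[of "\<gamma> - \<bar>\<omega>\<bar>"]]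
    by (simp add: power2_eq_square algebra_simps abs_mult_self_eq)
  then have "2 * T * \<gamma> * \<omega>^2 \<le> (T * \<bar>\<omega>\<bar>) * (\<gamma>^2 + \<omega>^2)"
    using mult_left_mono[OF _ less_imp_le[OF assms(1)]] by (fastforce simp: mult_ac)
  moreover have "\<gamma>^2 + \<omega>^2 > 0"
    using assms by (simp add: add_pos_nonneg)
  ultimately show ?thesis
    by (simp add: norm_Vfun_imag_axis[OF assms(2)] divide_le_eq)
qed

lemma Vfun_imag_axis_tendsto_one:
  assumes "T > 0"
  shows "((\<lambda>\<gamma>. Vfun T \<gamma> (\<i> * of_real \<omega>)) \<longlongrightarrow> 1) at_top"
proof -
  have "((\<lambda>\<gamma>. hfun T \<gamma> (\<i> * of_real \<omega>)) \<longlongrightarrow> 0) at_top"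
  proof (rule Lim_null_comparison)
    show "\<forall>\<^sub>F \<gamma> in at_top. cmod (hfun T \<gamma> (\<i> * of_real \<omega>)) \<le> 2 * T * \<omega>^2 / \<gamma>"
      using eventually_gt_at_top[of 0] by eventually_elim (use assms norm_hfun_imag_axis_le in auto)
    show "((\<lambda>\<gamma>. 2 * T * \<omega>^2 / \<gamma>) \<longlongrightarrow> 0) at_top"
      by (intro tendsto_divide_0[OF tendsto_const] filterlim_at_top_imp_at_infinity filterlim_ident)
  qed
  from tendsto_exp[OF this] show ?thesis
    by (simp add: Vfun_def)
qed

lemma norm_exp_sub_one_sub_le_square:
  fixes z :: complex
  assumes "norm z \<le> 1 / 2"
  shows "norm (exp z - 1 - z) \<le> norm z ^ 2"
proof (cases "z = 0")
  case False
  have sums: "(\<lambda>k. z ^ (k + 2) /\<^sub>R fact (k + 2)) sums (exp z - (\<Sum>k<2. z ^ k /\<^sub>R fact k))"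
    by (intro sums_split_initial_segment exp_converges)
  have norms_summable: "summable (\<lambda>k. norm (z ^ (k + 2) / fact (k + 2)))"
    using summable_norm_exp[of z]
    by (intro summable_norm summable_ignore_initial_segment)
       (auto simp: norm_power norm_divide divide_simps)
  have "summable (\<lambda>k. norm z ^ (k + 2) /\<^sub>R fact (k + 2))"
    using summable_norm_exp[of z]
    by (intro summable_norm summable_ignore_initial_segment)
       (auto simp: norm_power norm_divide divide_simps)
  also have "?this \<longleftrightarrow> summable (\<lambda>k. norm z ^ 2 * (norm z ^ k / fact (k + 2)))"
    by (simp add: power_add mult_ac divide_simps power2_eq_square del: of_nat_Suc of_nat_add)
  finally have summable: "summable (\<lambda>k. norm z ^ k / fact (k + 2))"
    using \<open>z \<noteq> 0\<close> by (subst (asm) summable_cmult_iff) auto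
  have "exp z - 1 - z = (\<Sum>k. z ^ (k + 2) / fact (k + 2))"
    using sums by (simp add: sums_iff scaleR_conv_of_real divide_simps eval_nat_numeral)
  also have "norm \<dots> \<le> (\<Sum>k. norm (z ^ (k + 2) / fact (k + 2)))"
    using norms_summable by (rule summable_norm)
  also have "\<dots> = (\<Sum>k. norm z ^ 2 * (norm z ^ k / fact (k + 2)))"
    by (simp add: power_add norm_power norm_divide mult_ac norm_mult power2_eq_square del: of_nat_Suc)
  also have "\<dots> = norm z ^ 2 * (\<Sum>k. norm z ^ k / fact (k + 2))"
    using summable by (rule suminf_mult)
  also have "\<dots> \<le> norm z ^ 2 * (1 / (1 - norm z) / 2)"
  proof (intro mult_left_mono sums_le[OF _ summable_sums[OF summable]])
    show "(\<lambda>k. norm z ^ k / 2) sums (1 / (1 - norm z) / 2)"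
      using assms by (intro geometric_sums sums_divide) auto
    fix k :: nat
    have "norm z ^ k / fact (k + 2) \<le> norm z ^ k / fact 2"
      by (intro divide_left_mono fact_mono) auto
    then show "norm z ^ k / fact (k + 2) \<le> norm z ^ k / 2"
      by simp
  qed simp
  also have "\<dots> \<le> norm z ^ 2"
    using assms by (intro mult_left_le) (auto simp: divide_simps)
  finally show ?thesis .
qed auto

lemma Vfun_imag_axis_uniformly_near_one:
  assumes "T > 0" "\<epsilon> > 0" "\<Omega> > 0"
  shows "\<exists>\<gamma>>0. \<forall>\<omega>\<in>{-\<Omega>..\<Omega>}. cmod (Vfun T \<gamma> (\<i> * of_real \<omega>) - 1) \<le> \<epsilon>"
proof -
  define \<delta> where "\<delta> = min (1 / 2) (\<epsilon> / 2)"
  have \<delta>: "\<delta> > 0" using assms by (simp add: \<delta>_def)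
  define \<gamma> where "\<gamma> = 2 * T * \<Omega>^2 / \<delta>"
  have \<gamma>: "\<gamma> > 0" using assms \<delta> by (simp add: \<gamma>_def)
  show ?thesis
  proof (intro exI[of _ \<gamma>] conjI \<gamma> ballI)
    fix \<omega> assume "\<omega> \<in> {-\<Omega>..\<Omega>}"
    then have "\<omega>^2 \<le> \<Omega>^2"
      using assms by (intro power2_le_iff_abs_le[THEN iffD2]) auto
    then have "2 * T * \<omega>^2 / \<gamma> \<le> \<delta>"
      using assms \<delta> \<gamma> by (simp add: \<gamma>_def field_simps)
    then have z: "cmod (hfun T \<gamma> (\<i> * of_real \<omega>)) \<le> \<delta>" (is "cmod ?z \<le> _")
      using norm_hfun_imag_axis_le[OF \<gamma> assms(1), of \<omega>] by linarith
    have "cmod (exp ?z - 1) \<le> cmod (exp ?z - 1 - ?z) + cmod ?z"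
      using norm_triangle_ineq[of "exp ?z - 1 - ?z" ?z] by simp
    also have "\<dots> \<le> cmod ?z ^ 2 + cmod ?z"
      using norm_exp_sub_one_sub_le_square[of ?z] z by (simp add: \<delta>_def)
    also have "\<dots> \<le> 2 * cmod ?z"
      using z by (simp add: power2_eq_square \<delta>_def mult_left_le)
    also have "\<dots> \<le> \<epsilon>"
      using z by (simp add: \<delta>_def)
    finally show "cmod (Vfun T \<gamma> (\<i> * of_real \<omega>) - 1) \<le> \<epsilon>"
      by (simp add: Vfun_def)
  qed
qed

lemma
  fixes h :: "real \<Rightarrow> 'b::{banach, second_countable_topology}"
  assumes [measurable]: "h \<in> borel_measurable lborel"
    and bound: "AE t in lborel. norm (h t) \<le> C"
    and support: "\<And>t. t \<notin> {a..b} \<Longrightarrow> h t = 0"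
  shows integrable_bounded_support: "integrable lborel h"
    and norm_integral_bounded_support_le: "a \<le> b \<Longrightarrow> norm (integral\<^sup>L lborel h) \<le> C * (b - a)"
proof -
  have ind: "integrable lborel (\<lambda>t. C * indicator {a..b} t :: real)"
    by (intro integrable_mult_right integrable_real_indicator) (auto simp: emeasure_lborel_Icc_eq)
  have dom: "AE t in lborel. norm (h t) \<le> C * indicator {a..b} t"
    using bound by eventually_elim (auto simp: indicator_def support)
  show int: "integrable lborel h"
    by (rule Bochner_Integration.integrable_bound[OF ind]) (use dom in \<open>auto elim: eventually_mono\<close>)
  assume "a \<le> b"
  have "norm (integral\<^sup>L lborel h) \<le> (LINT t|lborel. norm (h t))"
    by (rule integral_norm_bound)
  also have "\<dots> \<le> (LINT t|lborel. C * indicator {a..b} t)"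
    by (intro integral_mono_AE int ind integrable_norm dom)
  also have "\<dots> = C * (b - a)"
    using \<open>a \<le> b\<close> by simp
  finally show "norm (integral\<^sup>L lborel h) \<le> C * (b - a)" .
qed

definition laplace :: "(real \<Rightarrow> real) \<Rightarrow> complex \<Rightarrow> complex" where
  "laplace f p = (LINT t|lborel. exp (- (p * of_real t)) * of_real (f t))"

lemma laplace_imag_axis: "laplace f (\<i> * of_real \<omega>) = fourier f \<omega>"
  by (simp add: laplace_def fourier_def)

lemma norm_exp_window_le:
  assumes "t \<in> {-T..0}"
  shows "cmod (exp (- (p * of_real t))) \<le> exp (T * \<bar>Re p\<bar>)"
proof -
  have "- (Re p * t) \<le> \<bar>Re p\<bar> * \<bar>t\<bar>"
    by (metis abs_ge_minus_self abs_mult)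
  also have "\<dots> \<le> \<bar>Re p\<bar> * T"
    using assms by (intro mult_left_mono) auto
  finally show ?thesis
    by (simp add: norm_exp_eq_Re mult.commute)
qed

locale bounded_window_fun =
  fixes T M :: real and f :: "real \<Rightarrow> real"
  assumes T_pos: "T > 0" and M_nonneg: "M \<ge> 0"
    and f_measurable[measurable]: "f \<in> borel_measurable lborel"
    and bounded: "AE t in lborel. \<bar>f t\<bar> \<le> M"
    and support: "\<And>t. t \<notin> {-T..0} \<Longrightarrow> f t = 0"
begin

lemma
  fixes E :: "real \<Rightarrow> complex"
  assumes [measurable]: "E \<in> borel_measurable lborel"
    and E: "\<And>t. t \<in> {-T..0} \<Longrightarrow> cmod (E t) \<le> C"
  shows integrable_mult_window: "integrable lborel (\<lambda>t. E t * of_real (f t))"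
    and norm_integral_mult_window_le: "cmod (LINT t|lborel. E t * of_real (f t)) \<le> C * M * T"
proof -
  have bound: "AE t in lborel. cmod (E t * of_real (f t)) \<le> C * M"
    using bounded
  proof eventually_elim
    case (elim t)
    show ?case
    proof (cases "t \<in> {-T..0}")
      case True
      then have "C \<ge> 0"
        using E[OF True] norm_ge_zero order_trans by blast
      then show ?thesis
        unfolding norm_mult norm_of_real using elim E[OF True] by (intro mult_mono) auto
    next
      case False
      have "C \<ge> 0"
        using E[of 0] T_pos by (auto intro: order_trans[OF norm_ge_zero])
      then show ?thesis
        using M_nonneg
        using False by (simp add: support)
    qed
  qed
  have support': "\<And>t. t \<notin> {-T..0} \<Longrightarrow> E t * of_real (f t) = 0"
    by (simp add: support)
  have [measurable]: "(\<lambda>t. E t * of_real (f t)) \<in> borel_measurable lborel"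
    by measurable
  show "integrable lborel (\<lambda>t. E t * of_real (f t))"
    by (rule integrable_bounded_support[OF _ bound support']) measurable
  have "cmod (LINT t|lborel. E t * of_real (f t)) \<le> C * M * (0 - (- T))"
    by (rule norm_integral_bounded_support_le[OF _ bound support']) (use T_pos in auto)
  then show "cmod (LINT t|lborel. E t * of_real (f t)) \<le> C * M * T"
    by simp
qed

lemma measurable_laplace_kernel:
  "(\<lambda>t. exp (- (p * complex_of_real t))) \<in> borel_measurable lborel"
  by measurable

lemma integrable_laplace:
  fixes p :: complex
  shows "integrable lborel (\<lambda>t. exp (- (p * of_real t)) * of_real (f t))"
  by (rule integrable_mult_window[OF measurable_laplace_kernel norm_exp_window_le])

lemma norm_laplace_le: "cmod (laplace f p) \<le> exp (T * \<bar>Re p\<bar>) * M * T"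
  unfolding laplace_def
  by (rule norm_integral_mult_window_le[OF measurable_laplace_kernel norm_exp_window_le])

lemma integrable_laplace_derivative:
  fixes p :: complex
  shows "integrable lborel (\<lambda>t. (- of_real t * exp (- (p * of_real t))) * of_real (f t))"
proof (rule integrable_mult_window)
  fix t :: real assume t: "t \<in> {-T..0}"
  show "cmod (- of_real t * exp (- (p * of_real t))) \<le> T * exp (T * \<bar>Re p\<bar>)"
    unfolding norm_mult norm_minus_cancel norm_of_real
    using t norm_exp_window_le[OF t, of p] by (intro mult_mono) auto
qed measurable

lemma laplace_taylor_remainder_le:
  assumes h: "cmod h \<le> 1 / (2 * T)"
  shows "cmod (laplace f (p + h) - laplace f p
           - h * (LINT t|lborel. (- of_real t * exp (- (p * of_real t))) * of_real (f t)))
         \<le> exp (T * \<bar>Re p\<bar>) * (cmod h ^ 2 * T^2) * M * T"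
proof -
  define R where "R t = exp (- (p * of_real t)) * (exp (- (h * of_real t)) - 1 - (- (h * of_real t)))" for t
  have R: "cmod (R t) \<le> exp (T * \<bar>Re p\<bar>) * (cmod h ^ 2 * T^2)" if t: "t \<in> {-T..0}" for t
  proof -
    have ht: "cmod (- (h * of_real t)) \<le> cmod h * T"
      unfolding norm_minus_cancel norm_mult norm_of_real using t by (intro mult_left_mono) auto
    also have "\<dots> \<le> 1 / 2"
      using h T_pos by (simp add: field_simps)
    finally have "cmod (exp (- (h * of_real t)) - 1 - (- (h * of_real t))) \<le> cmod (h * of_real t) ^ 2"
      using norm_exp_sub_one_sub_le_square by fastforce
    also have "\<dots> \<le> (cmod h * T)^2"
      using ht by (intro power_mono) auto
    finally show ?thesis
      unfolding R_def norm_mult using norm_exp_window_le[OF t, of p]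
      by (intro mult_mono) (auto simp: power_mult_distrib)
  qed
  have "laplace f (p + h) - laplace f p
          - h * (LINT t|lborel. (- of_real t * exp (- (p * of_real t))) * of_real (f t))
        = (LINT t|lborel. exp (- ((p + h) * of_real t)) * of_real (f t)
             - exp (- (p * of_real t)) * of_real (f t)
             - h * ((- of_real t * exp (- (p * of_real t))) * of_real (f t)))"
    unfolding laplace_def
    using integrable_laplace[of "p + h"] integrable_laplace[of p] integrable_laplace_derivative[of p]
    by (simp add: integral_diff integrable_diff)
  also have "\<dots> = (LINT t|lborel. R t * of_real (f t))"
  proof (intro Bochner_Integration.integral_cong refl)
    fix t
    have "exp (- ((p + h) * of_real t)) = exp (- (p * of_real t)) * exp (- (h * of_real t))"
      by (simp add: exp_add[symmetric] algebra_simps)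
    then show "exp (- ((p + h) * of_real t)) * of_real (f t) - exp (- (p * of_real t)) * of_real (f t)
        - h * ((- of_real t * exp (- (p * of_real t))) * of_real (f t)) = R t * of_real (f t)"
      by (simp add: R_def algebra_simps)
  qed
  also have "cmod \<dots> \<le> exp (T * \<bar>Re p\<bar>) * (cmod h ^ 2 * T^2) * M * T"
    by (rule norm_integral_mult_window_le[OF _ R]) (auto simp: R_def)
  finally show ?thesis .
qed

lemma laplace_has_field_derivative:
  "(laplace f has_field_derivative
     (LINT t|lborel. (- of_real t * exp (- (p * of_real t))) * of_real (f t))) (at p)"
  (is "(_ has_field_derivative ?D) _")
proof -
  define C where "C = exp (T * \<bar>Re p\<bar>) * T^2 * M * T"
  have "((\<lambda>h. (laplace f (p + h) - laplace f p) / h - ?D) \<longlongrightarrow> 0) (at 0)"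
  proof (rule Lim_null_comparison)
    have "\<forall>\<^sub>F h in at (0::complex). h \<noteq> 0 \<and> cmod h < 1 / (2 * T)"
      using T_pos by (auto simp: eventually_at intro!: exI[of _ "1 / (2 * T)"])
    then show "\<forall>\<^sub>F h in at 0. cmod ((laplace f (p + h) - laplace f p) / h - ?D) \<le> C * cmod h"
    proof eventually_elim
      case (elim h)
      have "(laplace f (p + h) - laplace f p) / h - ?D = (laplace f (p + h) - laplace f p - h * ?D) / h"
        using elim by (simp add: field_simps)
      also have "cmod \<dots> \<le> exp (T * \<bar>Re p\<bar>) * (cmod h ^ 2 * T^2) * M * T / cmod h"
        unfolding norm_divide using elim by (intro divide_right_mono laplace_taylor_remainder_le) auto
      also have "\<dots> = C * cmod h"
        using elim by (simp add: C_def power2_eq_square field_simps)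
      finally show ?case .
    qed
    show "((\<lambda>h. C * cmod h) \<longlongrightarrow> 0) (at 0)"
      by (auto intro!: tendsto_eq_intros)
  qed
  then show ?thesis
    unfolding DERIV_def by (rule LIM_zero_cancel)
qed

lemma laplace_holomorphic: "laplace f holomorphic_on S"
  unfolding holomorphic_on_def field_differentiable_def
  using laplace_has_field_derivative has_field_derivative_at_within by blast

lemma laplace_continuous_on: "continuous_on S (laplace f)"
  using laplace_has_field_derivative by (intro continuous_at_imp_continuous_on) (auto intro: DERIV_isCont)

end

lemma integral_exp_window_harmonic:
  fixes j :: int
  assumes T: "T > 0"
  shows "(LINT t|lborel. indicator {-T..0} t *\<^sub>R exp (\<i> * of_real (of_int j * (2 * pi / T)) * of_real t))
     = (if j = 0 then T else 0)"
proof (cases "j = 0")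
  case True
  then show ?thesis using T by (simp add: scaleR_conv_of_real)
next
  case False
  define c where "c = \<i> * of_real (of_int j * (2 * pi / T))"
  have c0: "c \<noteq> 0" using False T by (simp add: c_def)
  have "(LINT t|lborel. indicator {-T..0} t *\<^sub>R exp (c * of_real t))
      = (LBINT t=ereal (-T)..ereal 0. exp (c * of_real t))"
    using T interval_integral_Icc[of "-T" 0 "\<lambda>t. exp (c * of_real t)"]
    by (simp add: set_lebesgue_integral_def zero_ereal_def)
  also have "\<dots> = exp (c * of_real 0) / c - exp (c * of_real (-T)) / c"
  proof (rule interval_integral_FTC_finite)
    show "continuous_on {min (- T) 0..max (- T) 0} (\<lambda>t. exp (c * complex_of_real t))"
      by (intro continuous_intros)
    fix x
    have "((\<lambda>z. exp (c * z) / c) has_field_derivative exp (c * of_real x)) (at (of_real x))"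
      using c0 by (auto intro!: derivative_eq_intros)
    then show "((\<lambda>t. exp (c * of_real t) / c) has_vector_derivative exp (c * of_real x))
        (at x within {min (- T) 0..max (- T) 0})"
      by (rule has_vector_derivative_real_field)
  qed
  also have "exp (c * of_real (-T)) = exp ((2 * of_int (-j) * pi) * \<i>)"
    using T by (simp add: c_def field_simps)
  also have "\<dots> = 1"
    by (rule exp_integer_2pi) simp
  finally show ?thesis
    using False by (simp add: c_def)
qed

lemma integral_exp_grid_orthogonal:
  fixes a :: real and n m :: nat
  assumes T: "T > 0"
  defines "e \<equiv> \<lambda>n t. exp (\<i> * of_real (a + real n * (2 * pi / T)) * of_real t)"
  shows "(LINT t|lborel. e n t * cnj (e m t) * of_real (indicator {-T..0} t)) = (if n = m then T else 0)"
proof -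
  have "e n t * cnj (e m t) * of_real (indicator {-T..0} t)
      = indicator {-T..0} t *\<^sub>R exp (\<i> * of_real (of_int (int n - int m) * (2 * pi / T)) * of_real t)" for t
  proof -
    have "e n t * cnj (e m t) = exp (\<i> * of_real (a + real n * (2 * pi / T)) * of_real t
                                      + - (\<i> * of_real (a + real m * (2 * pi / T)) * of_real t))"
      unfolding exp_add by (simp add: e_def exp_cnj)
    also have "\<i> * of_real (a + real n * (2 * pi / T)) * of_real t
                 + - (\<i> * of_real (a + real m * (2 * pi / T)) * of_real t)
             = \<i> * of_real (of_int (int n - int m) * (2 * pi / T)) * of_real t"
      by (simp add: algebra_simps add_divide_distrib diff_divide_distrib)
    finally show ?thesis
      by (simp add: scaleR_conv_of_real mult.commute)
  qed
  then show ?thesis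
    using integral_exp_window_harmonic[OF T, of "int n - int m"] by simp
qed

lemma
  fixes c :: "nat \<Rightarrow> complex" and a :: real and N :: nat
  assumes T: "T > 0"
  defines "u \<equiv> \<lambda>t. \<Sum>n<N. c n * exp (\<i> * of_real (a + real n * (2 * pi / T)) * of_real t)"
  shows integrable_norm_exp_sum_window:
      "integrable lborel (\<lambda>t. (cmod (u t))\<^sup>2 * indicator {-T..0} t)"
    and integral_norm_exp_sum_window:
      "(LINT t|lborel. (cmod (u t))\<^sup>2 * indicator {-T..0} t) = T * (\<Sum>n<N. (cmod (c n))\<^sup>2)"
proof -
  define e where "e n t = exp (\<i> * of_real (a + real n * (2 * pi / T)) * of_real t)" for n t
  define chi where "chi t = (indicator {-T..0} t :: real)" for t
  have [measurable]: "e n \<in> borel_measurable lborel" for n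
    unfolding e_def by measurable
  have [measurable]: "(\<lambda>t. cnj (e n t)) \<in> borel_measurable lborel" for n
    unfolding e_def by (simp add: exp_cnj, measurable)
  have [measurable]: "chi \<in> borel_measurable lborel"
    unfolding chi_def by measurable
  have "cmod (u t) \<le> (\<Sum>n<N. cmod (c n))" for t
    unfolding u_def by (rule order_trans[OF norm_sum]) (simp add: norm_mult norm_exp_eq_Re)
  then have bound: "norm ((cmod (u t))\<^sup>2 * indicator {-T..0} t) \<le> (\<Sum>n<N. cmod (c n))\<^sup>2" for t
    by (auto simp: indicator_def intro!: power_mono)
  show "integrable lborel (\<lambda>t. (cmod (u t))\<^sup>2 * indicator {-T..0} t)"
    by (rule integrable_bounded_support[where a="-T" and b=0, OF _ AE_I2[OF bound]]) (auto simp: u_def)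
  have orth: "(LINT t|lborel. e n t * cnj (e m t) * of_real (chi t)) = (if n = m then T else 0)" for n m
    unfolding e_def chi_def by (rule integral_exp_grid_orthogonal[OF T])
  have int_e: "integrable lborel (\<lambda>t. e n t * cnj (e m t) * of_real (chi t))" for n m
    by (rule integrable_bounded_support[where C=1 and a="-T" and b=0])
       (measurable, auto simp: norm_mult e_def norm_exp_eq_Re chi_def)
  have u_e: "u t = (\<Sum>n<N. c n * e n t)" for t
    by (simp add: u_def e_def)
  have "of_real ((cmod (u t))\<^sup>2 * chi t)
      = (\<Sum>n<N. \<Sum>m<N. c n * cnj (c m) * (e n t * cnj (e m t) * of_real (chi t)))" for t
  proof -
    have "of_real ((cmod (u t))\<^sup>2 * chi t) = (u t * cnj (u t)) * of_real (chi t)"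
      by (simp only: of_real_mult complex_norm_square)
    also have "\<dots> = (\<Sum>n<N. \<Sum>m<N. c n * cnj (c m) * (e n t * cnj (e m t) * of_real (chi t)))"
      unfolding u_e cnj_sum sum_product sum_distrib_right
      by (intro sum.cong refl) (simp add: sum_distrib_left mult_ac)
    finally show ?thesis .
  qed
  then have "of_real (LINT t|lborel. (cmod (u t))\<^sup>2 * chi t)
      = (\<Sum>n<N. \<Sum>m<N. c n * cnj (c m) * (if n = m then T else 0))"
    using int_e by (simp add: integral_sum integrable_sum orth flip: integral_complex_of_real)
  also have "\<dots> = of_real (T * (\<Sum>n<N. (cmod (c n))\<^sup>2))"
    by (simp add: if_distrib complex_norm_square sum_distrib_left mult_ac del: of_real_power cong: if_cong)
  finally show "(LINT t|lborel. (cmod (u t))\<^sup>2 * indicator {-T..0} t) = T * (\<Sum>n<N. (cmod (c n))\<^sup>2)"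
    unfolding chi_def of_real_eq_iff .
qed

context bounded_window_fun
begin

lemma integrable_square: "integrable lborel (\<lambda>t. (f t)\<^sup>2)"
  and integral_square_le: "(LINT t|lborel. (f t)\<^sup>2) \<le> M\<^sup>2 * T"
proof -
  have bound: "AE t in lborel. norm ((f t)\<^sup>2) \<le> M\<^sup>2"
    using bounded by eventually_elim (simp, metis abs_ge_zero power2_abs power_mono)
  show "integrable lborel (\<lambda>t. (f t)\<^sup>2)"
    by (rule integrable_bounded_support[where a="-T" and b=0, OF _ bound]) (auto simp: support)
  have "norm (LINT t|lborel. (f t)\<^sup>2) \<le> M\<^sup>2 * (0 - - T)"
    by (rule norm_integral_bounded_support_le[OF _ bound]) (use T_pos support in auto)
  then show "(LINT t|lborel. (f t)\<^sup>2) \<le> M\<^sup>2 * T"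
    by simp
qed

lemma
  fixes c :: "nat \<Rightarrow> complex" and w :: "nat \<Rightarrow> real" and N :: nat
  defines "u \<equiv> \<lambda>t. \<Sum>n<N. c n * exp (\<i> * of_real (w n) * of_real t)"
  shows integrable_cnj_exp_sum_mult: "integrable lborel (\<lambda>t. cnj (u t) * of_real (f t))"
    and integral_cnj_exp_sum_mult:
      "(LINT t|lborel. cnj (u t) * of_real (f t)) = (\<Sum>n<N. cnj (c n) * laplace f (\<i> * of_real (w n)))"
proof -
  have cnj_u: "cnj (u t) * of_real (f t)
      = (\<Sum>n<N. cnj (c n) * (exp (- (\<i> * of_real (w n) * of_real t)) * of_real (f t)))" for t
    by (simp add: u_def cnj_sum exp_cnj sum_distrib_right mult.assoc)
  show "integrable lborel (\<lambda>t. cnj (u t) * of_real (f t))"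
    unfolding cnj_u by (intro Bochner_Integration.integrable_sum integrable_mult_right integrable_laplace)
  show "(LINT t|lborel. cnj (u t) * of_real (f t)) = (\<Sum>n<N. cnj (c n) * laplace f (\<i> * of_real (w n)))"
    unfolding cnj_u laplace_def by (simp add: integral_sum integrable_laplace)
qed

text \<open>In Bessel's inequality u/T is the orthogonal projection of f; the proof expands
  0 \<le> \<integral> |f - u 1_[-T,0] / T|^2.\<close>

lemma le_integral_square_if_correlation:
  fixes u :: "real \<Rightarrow> complex"
  assumes [measurable]: "u \<in> borel_measurable lborel"
    and int_fu: "integrable lborel (\<lambda>t. cnj (u t) * of_real (f t))"
    and fu: "(LINT t|lborel. cnj (u t) * of_real (f t)) = of_real S"
    and int_uu: "integrable lborel (\<lambda>t. (cmod (u t))\<^sup>2 * indicator {-T..0} t)"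
    and uu: "(LINT t|lborel. (cmod (u t))\<^sup>2 * indicator {-T..0} t) = T * S"
  shows "S \<le> T * (LINT t|lborel. (f t)\<^sup>2)"
proof -
  define chi where "chi t = (indicator {-T..0} t :: real)" for t
  have expand: "(cmod (of_real (f t) - u t * of_real (chi t / T)))\<^sup>2
      = (f t)\<^sup>2 - 2 / T * Re (cnj (u t) * of_real (f t)) + (cmod (u t))\<^sup>2 * chi t / T\<^sup>2" for t
  proof (cases "t \<in> {-T..0}")
    case True
    then show ?thesis
      using T_pos by (simp add: chi_def cmod_power2) (simp add: power2_eq_square field_simps)
  next
    case False
    then show ?thesis
      by (simp add: chi_def support)
  qed
  have int_re: "integrable lborel (\<lambda>t. 2 / T * Re (cnj (u t) * of_real (f t)))"
    using int_fu by (intro integrable_mult_right integrable_Re)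
  have int_uu': "integrable lborel (\<lambda>t. (cmod (u t))\<^sup>2 * chi t / T\<^sup>2)"
    using int_uu by (simp add: chi_def)
  have "0 \<le> (LINT t|lborel. (cmod (of_real (f t) - u t * of_real (chi t / T)))\<^sup>2)"
    by simp
  also have "\<dots> = (LINT t|lborel. (f t)\<^sup>2) - 2 / T * Re (LINT t|lborel. cnj (u t) * of_real (f t))
                  + (LINT t|lborel. (cmod (u t))\<^sup>2 * chi t) / T\<^sup>2"
    unfolding expand
      Bochner_Integration.integral_add[OF Bochner_Integration.integrable_diff[OF integrable_square int_re] int_uu']
      Bochner_Integration.integral_diff[OF integrable_square int_re]
    by (simp only: integral_mult_right_zero integral_divide_zero integral_Re[OF int_fu])
  also have "\<dots> = (LINT t|lborel. (f t)\<^sup>2) - S / T"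
    unfolding fu uu[folded chi_def] using T_pos by (simp add: field_simps power2_eq_square)
  finally show ?thesis
    using T_pos by (simp add: field_simps)
qed

lemma bessel_window:
  "(\<Sum>n<N. (cmod (laplace f (\<i> * of_real (a + real n * (2 * pi / T)))))\<^sup>2)
     \<le> T * (LINT t|lborel. (f t)\<^sup>2)"
proof -
  define w where "w n = a + real n * (2 * pi / T)" for n
  define c where "c n = laplace f (\<i> * of_real (w n))" for n
  define u where "u t = (\<Sum>n<N. c n * exp (\<i> * of_real (w n) * of_real t))" for t
  have [measurable]: "u \<in> borel_measurable lborel"
    unfolding u_def by measurable
  have "(\<Sum>n<N. cnj (c n) * c n) = of_real (\<Sum>n<N. (cmod (c n))\<^sup>2)"
    by (simp add: complex_norm_square mult.commute del: of_real_power)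
  then show ?thesis
    using le_integral_square_if_correlation[of u "\<Sum>n<N. (cmod (c n))\<^sup>2"]
      integrable_cnj_exp_sum_mult[of c w N] integral_cnj_exp_sum_mult[of c w N]
      integrable_norm_exp_sum_window[OF T_pos, where c=c and N=N and a=a]
      integral_norm_exp_sum_window[OF T_pos, where c=c and N=N and a=a]
    by (simp add: u_def[abs_def] c_def w_def)
qed

lemma sum_norm_laplace_grid_le:
  "(\<Sum>n<N. (cmod (laplace f (\<i> * of_real (a + real n * (2 * pi / T)))))\<^sup>2) \<le> M\<^sup>2 * T\<^sup>2"
  using order_trans[OF bessel_window mult_left_mono[OF integral_square_le]] T_pos
  by (simp add: power2_eq_square mult_ac)

end

lemma indicator_atLeastLessThan_eq_sum:
  fixes a P :: real
  assumes "P > 0"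
  shows "indicator {a..<a + real K * P} x
           = (\<Sum>n<K. indicator {a + real n * P..<a + real n * P + P} x :: real)"
proof (induction K)
  case (Suc K)
  have "0 \<le> P * real K"
    using assms by simp
  then have "indicator {a..<a + real (Suc K) * P} x
      = (indicator {a..<a + real K * P} x + indicator {a + real K * P..<a + real K * P + P} x :: real)"
    using assms by (auto simp: indicator_def algebra_simps) (use \<open>0 \<le> P * real K\<close> in linarith)+
  then show ?case
    using Suc by simp
qed simp

context bounded_window_fun
begin

definition power_spectrum :: "real \<Rightarrow> real" where
  "power_spectrum \<omega> = (cmod (laplace f (\<i> * of_real \<omega>)))\<^sup>2"

lemma power_spectrum_nonneg: "power_spectrum \<omega> \<ge> 0"
  by (simp add: power_spectrum_def)

lemma measurable_power_spectrum[measurable]: "power_spectrum \<in> borel_measurable borel"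
  unfolding power_spectrum_def
  by (intro borel_measurable_continuous_onI continuous_intros
      continuous_on_compose2[OF laplace_continuous_on[of UNIV]]) auto

lemma nn_integral_power_spectrum_blocks_le:
  defines "P \<equiv> 2 * pi / T"
  shows "(\<integral>\<^sup>+ \<omega>. ennreal (power_spectrum \<omega> * indicator {a..<a + real K * P} \<omega>) \<partial>lborel)
           \<le> ennreal (P * (M\<^sup>2 * T\<^sup>2))"
proof -
  have P: "P > 0"
    using T_pos by (simp add: P_def)
  have shift: "(\<integral>\<^sup>+ \<omega>. ennreal (power_spectrum \<omega> * indicator {b..<b + P} \<omega>) \<partial>lborel)
      = (\<integral>\<^sup>+ x. ennreal (power_spectrum (b + x) * indicator {0..<P} x) \<partial>lborel)" for b
    using nn_integral_real_affine[where c=1 and t=b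
        and f="\<lambda>\<omega>. ennreal (power_spectrum \<omega> * indicator {b..<b + P} \<omega>)"]
    by (simp add: indicator_def)
  have "(\<integral>\<^sup>+ \<omega>. ennreal (power_spectrum \<omega> * indicator {a..<a + real K * P} \<omega>) \<partial>lborel)
      = (\<integral>\<^sup>+ \<omega>. (\<Sum>n<K. ennreal (power_spectrum \<omega> * indicator {a + real n * P..<a + real n * P + P} \<omega>)) \<partial>lborel)"
    by (intro nn_integral_cong)
       (simp add: indicator_atLeastLessThan_eq_sum[OF P] sum_distrib_left power_spectrum_nonneg)
  also have "\<dots> = (\<Sum>n<K. (\<integral>\<^sup>+ \<omega>. ennreal (power_spectrum \<omega> * indicator {a + real n * P..<a + real n * P + P} \<omega>) \<partial>lborel))"
    by (intro nn_integral_sum) measurable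
  also have "\<dots> = (\<integral>\<^sup>+ x. (\<Sum>n<K. ennreal (power_spectrum (a + real n * P + x) * indicator {0..<P} x)) \<partial>lborel)"
    unfolding shift by (intro nn_integral_sum[symmetric]) measurable
  also have "\<dots> \<le> (\<integral>\<^sup>+ x. ennreal (M\<^sup>2 * T\<^sup>2 * indicator {0..<P} x) \<partial>lborel)"
  proof (intro nn_integral_mono)
    fix x
    have "(\<Sum>n<K. power_spectrum (a + x + real n * P)) \<le> M\<^sup>2 * T\<^sup>2"
      using sum_norm_laplace_grid_le[where N=K and a="a + x"] by (simp add: power_spectrum_def P_def)
    then have "(\<Sum>n<K. power_spectrum (a + real n * P + x) * indicator {0..<P} x) \<le> M\<^sup>2 * T\<^sup>2 * indicator {0..<P} x"
      by (simp add: sum_distrib_right[symmetric] indicator_def add_ac)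
    then show "(\<Sum>n<K. ennreal (power_spectrum (a + real n * P + x) * indicator {0..<P} x))
        \<le> ennreal (M\<^sup>2 * T\<^sup>2 * indicator {0..<P} x)"
      by (subst sum_ennreal) (auto simp: power_spectrum_nonneg intro!: ennreal_leI)
  qed
  also have "\<dots> = ennreal (M\<^sup>2 * T\<^sup>2) * P"
    using P by (simp add: nn_integral_cmult ennreal_mult ennreal_indicator)
  also have "\<dots> = ennreal (P * (M\<^sup>2 * T\<^sup>2))"
    using P by (simp add: ennreal_mult mult.commute)
  finally show ?thesis .
qed

lemma
  shows integrable_power_spectrum: "integrable lborel power_spectrum"
    and integral_power_spectrum_le: "(LINT \<omega>|lborel. power_spectrum \<omega>) \<le> 2 * pi * T * M\<^sup>2"
proof -
  define P where "P = 2 * pi / T"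
  have P: "P > 0"
    using T_pos by (simp add: P_def)
  have B: "P * (M\<^sup>2 * T\<^sup>2) = 2 * pi * T * M\<^sup>2"
    using T_pos by (simp add: P_def power2_eq_square)
  define I where "I N = {-(real N * P)..<-(real N * P) + real (2 * N) * P}" for N :: nat
  have inc: "incseq (\<lambda>N \<omega>. ennreal (power_spectrum \<omega> * indicator (I N) \<omega>))"
  proof (intro incseq_SucI le_funI ennreal_leI mult_left_mono)
    fix N \<omega>
    have "I N \<subseteq> I (Suc N)"
      using P by (auto simp: I_def algebra_simps)
    then show "indicator (I N) \<omega> \<le> (indicator (I (Suc N)) \<omega> :: real)"
      by (auto simp: indicator_def)
  qed (rule power_spectrum_nonneg)
  have sup: "(SUP N. ennreal (power_spectrum \<omega> * indicator (I N) \<omega>)) = ennreal (power_spectrum \<omega>)" for \<omega>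
  proof (rule antisym)
    show "(SUP N. ennreal (power_spectrum \<omega> * indicator (I N) \<omega>)) \<le> ennreal (power_spectrum \<omega>)"
      using power_spectrum_nonneg[of \<omega>] by (intro SUP_least ennreal_leI) (auto simp: indicator_def)
    obtain N :: nat where "\<bar>\<omega>\<bar> / P < real N"
      using reals_Archimedean2 by blast
    then have "\<omega> \<in> I N"
      using P by (auto simp: I_def field_simps)
    then show "ennreal (power_spectrum \<omega>) \<le> (SUP N. ennreal (power_spectrum \<omega> * indicator (I N) \<omega>))"
      by (intro SUP_upper2[of N]) auto
  qed
  have "(\<integral>\<^sup>+ \<omega>. ennreal (power_spectrum \<omega>) \<partial>lborel)
      = (SUP N. (\<integral>\<^sup>+ \<omega>. ennreal (power_spectrum \<omega> * indicator (I N) \<omega>) \<partial>lborel))"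
    unfolding sup[symmetric] by (rule nn_integral_monotone_convergence_SUP[OF inc]) (simp add: I_def)
  also have "\<dots> \<le> ennreal (2 * pi * T * M\<^sup>2)"
    unfolding B[symmetric] I_def P_def by (intro SUP_least nn_integral_power_spectrum_blocks_le)
  finally have nn: "(\<integral>\<^sup>+ \<omega>. ennreal (power_spectrum \<omega>) \<partial>lborel) \<le> ennreal (2 * pi * T * M\<^sup>2)" .
  show int: "integrable lborel power_spectrum"
    by (rule integrableI_nonneg)
       (use nn power_spectrum_nonneg in \<open>auto simp: top_unique intro: le_less_trans\<close>)
  show "(LINT \<omega>|lborel. power_spectrum \<omega>) \<le> 2 * pi * T * M\<^sup>2"
    using nn nn_integral_eq_integral[OF int] power_spectrum_nonneg T_pos M_nonneg
    by (simp add: ennreal_le_iff)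
qed

lemma bounded_window_fun_damped:
  assumes "s \<ge> 0"
  shows "bounded_window_fun T (M * exp (T * s)) (\<lambda>t. exp (- s * t) * f t)"
proof
  show "AE t in lborel. \<bar>exp (- s * t) * f t\<bar> \<le> M * exp (T * s)"
    using bounded
  proof eventually_elim
    case (elim t)
    show ?case
    proof (cases "t \<in> {-T..0}")
      case True
      then have "s * - t \<le> s * T"
        using assms by (intro mult_left_mono) auto
      then have "exp (- s * t) \<le> exp (T * s)"
        by (simp add: mult.commute)
      then show ?thesis
        unfolding abs_mult using elim by (simp add: mult.commute mult_mono)
    next
      case False
      then show ?thesis
        using M_nonneg by (simp add: support)
    qed
  qed
qed (use T_pos M_nonneg support in auto)

lemma laplace_Complex_eq:
  "laplace f (Complex s \<omega>) = laplace (\<lambda>t. exp (- s * t) * f t) (\<i> * of_real \<omega>)"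
  unfolding laplace_def
proof (intro Bochner_Integration.integral_cong refl)
  fix t
  have "- (Complex s \<omega> * of_real t) = of_real (- s * t) + - (\<i> * of_real \<omega> * of_real t)"
    by (simp add: Complex_eq algebra_simps)
  then have "exp (- (Complex s \<omega> * of_real t)) = exp (of_real (- s * t)) * exp (- (\<i> * of_real \<omega> * of_real t))"
    by (simp only: exp_add)
  then have "exp (- (Complex s \<omega> * of_real t)) = of_real (exp (- s * t)) * exp (- (\<i> * of_real \<omega> * of_real t))"
    by (simp only: exp_of_real)
  then show "exp (- (Complex s \<omega> * of_real t)) * of_real (f t)
      = exp (- (\<i> * of_real \<omega> * of_real t)) * of_real (exp (- s * t) * f t)"
    by simp
qed

lemma norm_Vfun_laplace_le:
  assumes "\<gamma> > 0" "Re p \<ge> 0"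
  shows "cmod (Vfun T \<gamma> p * laplace f p) \<le> exp (2 * T * \<gamma> - T * Re p) * M * T"
proof -
  have "cmod (Vfun T \<gamma> p * laplace f p) \<le> exp (2 * T * \<gamma> - 2 * T * Re p) * (exp (T * \<bar>Re p\<bar>) * M * T)"
    unfolding norm_mult by (intro mult_mono norm_Vfun_le norm_laplace_le) (use assms T_pos in auto)
  also have "\<dots> = exp (2 * T * \<gamma> - T * Re p) * M * T"
    using assms by (simp add: mult_exp_exp algebra_simps)
  finally show ?thesis .
qed

lemma hardy_inf_Vfun_laplace:
  assumes "\<gamma> > 0"
  shows "hardy_inf (\<lambda>p. Vfun T \<gamma> p * laplace f p)"
  unfolding hardy_inf_def
proof (intro conjI exI ballI)
  show "(\<lambda>p. Vfun T \<gamma> p * laplace f p) holomorphic_on rhp"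
    using hardy_inf_Vfun[OF T_pos assms] by (intro holomorphic_intros laplace_holomorphic)
      (simp add: hardy_inf_def)
next
  fix p assume "p \<in> rhp"
  then have "Re p \<ge> 0"
    by (simp add: rhp_def)
  have "exp (2 * T * \<gamma> - T * Re p) * M * T \<le> exp (2 * T * \<gamma>) * M * T"
    using \<open>Re p \<ge> 0\<close> T_pos M_nonneg by (intro mult_right_mono) auto
  then show "cmod (Vfun T \<gamma> p * laplace f p) \<le> exp (2 * T * \<gamma>) * M * T"
    using norm_Vfun_laplace_le[OF assms \<open>Re p \<ge> 0\<close>] by linarith
qed

lemma line_integral_Vfun_laplace_le:
  assumes "\<gamma> > 0" "s > 0"
  shows "integrable lborel (\<lambda>\<omega>. cmod (Vfun T \<gamma> (Complex s \<omega>) * laplace f (Complex s \<omega>)) powr 2)"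
    and "(LINT \<omega>|lborel. cmod (Vfun T \<gamma> (Complex s \<omega>) * laplace f (Complex s \<omega>)) powr 2)
           \<le> 2 * pi * T * M\<^sup>2 * exp (4 * T * \<gamma>)"
proof -
  interpret damped: bounded_window_fun T "M * exp (T * s)" "\<lambda>t. exp (- s * t) * f t"
    using assms(2) by (rule bounded_window_fun_damped[OF less_imp_le])
  define K where "K \<omega> = Vfun T \<gamma> (Complex s \<omega>) * laplace f (Complex s \<omega>)" for \<omega>
  define c where "c = exp (2 * T * \<gamma> - 2 * T * s)"
  have pointwise: "cmod (K \<omega>) powr 2 \<le> c\<^sup>2 * damped.power_spectrum \<omega>" for \<omega>
  proof -
    have "cmod (K \<omega>) \<le> c * cmod (laplace (\<lambda>t. exp (- s * t) * f t) (\<i> * of_real \<omega>))"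
      unfolding K_def norm_mult laplace_Complex_eq c_def
      using norm_Vfun_le[OF T_pos assms(1), of "Complex s \<omega>"] assms(2) by (intro mult_right_mono) auto
    then have "(cmod (K \<omega>))\<^sup>2 \<le> (c * cmod (laplace (\<lambda>t. exp (- s * t) * f t) (\<i> * of_real \<omega>)))\<^sup>2"
      by (intro power_mono) auto
    then show ?thesis
      unfolding damped.power_spectrum_def by (simp add: power_mult_distrib)
  qed
  have "continuous_on UNIV (\<lambda>\<omega>. Vfun T \<gamma> (of_real s + \<i> * of_real \<omega>) * laplace f (of_real s + \<i> * of_real \<omega>))"
    by (intro continuous_intros continuous_on_compose2[OF Vfun_continuous_on[OF assms(1)]]
        continuous_on_compose2[OF laplace_continuous_on[of UNIV]]) (use assms(2) in auto)
  then have [measurable]: "K \<in> borel_measurable borel"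
    unfolding K_def Complex_eq by (rule borel_measurable_continuous_onI)
  have int_bound: "integrable lborel (\<lambda>\<omega>. c\<^sup>2 * damped.power_spectrum \<omega>)"
    by (intro integrable_mult_right damped.integrable_power_spectrum)
  show int: "integrable lborel (\<lambda>\<omega>. cmod (K \<omega>) powr 2)"
    by (rule Bochner_Integration.integrable_bound[OF int_bound])
       (use pointwise damped.power_spectrum_nonneg in \<open>auto intro!: AE_I2 order_trans[OF _ abs_ge_self]\<close>)
  have "(LINT \<omega>|lborel. cmod (K \<omega>) powr 2) \<le> (LINT \<omega>|lborel. c\<^sup>2 * damped.power_spectrum \<omega>)"
    by (intro integral_mono int int_bound pointwise)
  also have "\<dots> \<le> c\<^sup>2 * (2 * pi * T * (M * exp (T * s))\<^sup>2)"
    unfolding integral_mult_right_zero by (intro mult_left_mono damped.integral_power_spectrum_le) simp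
  also have "\<dots> = 2 * pi * T * M\<^sup>2 * exp (4 * T * \<gamma> - 2 * T * s)"
    by (simp add: c_def power2_eq_square mult_exp_exp algebra_simps)
  also have "\<dots> \<le> 2 * pi * T * M\<^sup>2 * exp (4 * T * \<gamma>)"
    using T_pos assms(2) by (intro mult_left_mono) auto
  finally show "(LINT \<omega>|lborel. cmod (K \<omega>) powr 2) \<le> 2 * pi * T * M\<^sup>2 * exp (4 * T * \<gamma>)" .
qed

lemma hardy2_Vfun_laplace:
  assumes "\<gamma> > 0"
  shows "hardy 2 (\<lambda>p. Vfun T \<gamma> p * laplace f p)"
  unfolding hardy_def
proof (intro conjI allI impI exI[of _ "(2 * pi * T * M\<^sup>2 * exp (4 * T * \<gamma>)) powr (1 / 2)"])
  show "(\<lambda>p. Vfun T \<gamma> p * laplace f p) holomorphic_on rhp"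
    using hardy_inf_Vfun_laplace[OF assms] by (simp add: hardy_inf_def)
  fix s :: real assume "s > 0"
  note line = line_integral_Vfun_laplace_le[OF assms this]
  show "integrable lborel (\<lambda>\<omega>. cmod (Vfun T \<gamma> (Complex s \<omega>) * laplace f (Complex s \<omega>)) powr 2)"
    by (rule line(1))
  show "(LINT \<omega>|lborel. cmod (Vfun T \<gamma> (Complex s \<omega>) * laplace f (Complex s \<omega>)) powr 2) powr (1 / 2)
      \<le> (2 * pi * T * M\<^sup>2 * exp (4 * T * \<gamma>)) powr (1 / 2)"
    using line(2) by (intro powr_mono2) auto
qed

end

lemma Kclass_imp_bounded_window_fun:
  assumes "T > 0" "k \<in> Kclass T"
  obtains M where "bounded_window_fun T M k"
proof -
  obtain B where "k \<in> borel_measurable lborel" "AE t in lborel. \<bar>k t\<bar> \<le> B"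
    "\<And>t. t \<notin> {-T..0} \<Longrightarrow> k t = 0"
    using assms(2) unfolding Kclass_def by blast
  then have "bounded_window_fun T (max B 0) k"
    using assms(1) by unfold_locales (auto elim: eventually_mono)
  then show ?thesis ..
qed

theorem lemma1:
  fixes T \<gamma> :: real and k :: "real \<Rightarrow> real"
  assumes "T > 0" and "\<gamma> > 0" and "k \<in> Kclass T"
  shows
    "(hardy_inf (Vfun T \<gamma>) \<and>
     (\<exists>Khat. hardy 2 Khat \<and> hardy_inf Khat \<and>
        continuous_on {p. Re p \<ge> 0} Khat \<and>
        (\<forall>\<omega>::real. Khat (\<i> * of_real \<omega>) = Vfun T \<gamma> (\<i> * of_real \<omega>) * fourier k \<omega>))) \<and>
    (\<forall>\<omega>::real. cmod (Vfun T \<gamma> (\<i> * of_real \<omega>)) =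
        exp (2 * T * \<gamma> * \<omega>^2 / (\<gamma>^2 + \<omega>^2))) \<and>
    (\<forall>\<omega>::real. bdd_above ((\<lambda>c. cmod (Vfun T c (\<i> * of_real \<omega>))) ` {0<..}) \<and>
        (SUP c\<in>{0<..}. cmod (Vfun T c (\<i> * of_real \<omega>))) \<le> exp (T * \<bar>\<omega>\<bar>)) \<and>
    (\<forall>\<omega>::real. ((\<lambda>c. Vfun T c (\<i> * of_real \<omega>)) \<longlongrightarrow> 1) at_top) \<and>
    (\<forall>\<epsilon>>0. \<forall>\<Omega>>0. \<exists>c>0. \<forall>\<omega>\<in>{-\<Omega>..\<Omega>}.
        cmod (Vfun T c (\<i> * of_real \<omega>) - 1) \<le> \<epsilon>)"
proof -
  obtain M where "bounded_window_fun T M k"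
    using Kclass_imp_bounded_window_fun[OF assms(1,3)] .
  then interpret k: bounded_window_fun T M k .
  have "continuous_on {p. Re p \<ge> 0} (\<lambda>p. Vfun T \<gamma> p * laplace k p)"
    by (intro continuous_intros Vfun_continuous_on[OF assms(2)] k.laplace_continuous_on)
  then have part_i: "\<exists>Khat. hardy 2 Khat \<and> hardy_inf Khat \<and> continuous_on {p. Re p \<ge> 0} Khat \<and>
      (\<forall>\<omega>::real. Khat (\<i> * of_real \<omega>) = Vfun T \<gamma> (\<i> * of_real \<omega>) * fourier k \<omega>)"
    using k.hardy2_Vfun_laplace[OF assms(2)] k.hardy_inf_Vfun_laplace[OF assms(2)]
    by (intro exI[of _ "\<lambda>p. Vfun T \<gamma> p * laplace k p"]) (simp add: laplace_imag_axis)
  have part_iii: "bdd_above ((\<lambda>c. cmod (Vfun T c (\<i> * of_real \<omega>))) ` {0<..}) \<and>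
      (SUP c\<in>{0<..}. cmod (Vfun T c (\<i> * of_real \<omega>))) \<le> exp (T * \<bar>\<omega>\<bar>)" for \<omega>
    using norm_Vfun_imag_axis_le_exp_abs[OF assms(1)]
    by (auto intro!: bdd_aboveI cSUP_least)
  show ?thesis
    using hardy_inf_Vfun[OF assms(1,2)] part_i norm_Vfun_imag_axis[OF assms(2)] part_iii
      Vfun_imag_axis_tendsto_one[OF assms(1)] Vfun_imag_axis_uniformly_near_one[OF assms(1)]
    by blast
qed

end
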